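(* Let $n\ge 2$ be an integer and $u>0$ a real number. Suppose $\Theta,\Theta'$ are independent random vectors, each uniformly distributed on $\Delta^{n,u}$. Then $$\mathbb{P}(\Theta\le_{\mathrm{hr}}\Theta')=\frac{1}{2^{n-1}}.$$
   Context: For an integer $n$ and real $u>0$, the $n$-simplex of size $u$ is $\Delta^{n,u}=\{(\theta_1,\ldots,\theta_n)\in\mathbb{R}^n : \theta_1+\cdots+\theta_n=u,\ \theta_i\ge 0 \text{ for } 1\le i\le n\}$. A random vector $\Theta$ is uniformly distributed on $\Delta^{n,u}$, written $\Theta\sim\mathcal{U}(\Delta^{n,u})$, if $\mathbb{P}(\Theta\in C)=\mathrm{Vol}(C)/\mathrm{Vol}(\Delta^{n,u})$ for every measurable $C\subseteq\Delta^{n,u}$, where $\mathrm{Vol}$ is the $(n-1)$-dimensional volume. Hazard rate order: for $\theta=(\theta_1,\ldots,\theta_n),\theta'=(\theta'_1,\ldots,\theta'_n)\in\Delta^{n,u}$, one writes $\theta\le_{\mathrm{hr}}\theta'$ if $$\Big(\sum_{k=i}^n\theta_k\Big)\Big(\sum_{k=j}^n\theta'_k\Big)\ge\Big(\sum_{k=j}^n\theta_k\Big)\Big(\sum_{k=i}^n\theta'_k\Big)\quad\text{for all } 1\le i\le j\le n.$$ *)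

theory Defs
  imports "HOL-Probability.Probability"
begin

text \<open>
  Vectors of dimension \<open>n\<close> are functions in \<^term>\<open>{1..n} \<rightarrow>\<^sub>E (UNIV :: real set)\<close>, the carrier of the
  product spaces below; \<^term>\<open>Pi\<^sub>M {1..n} (\<lambda>_. borel :: real measure)\<close> carries the Borel sets and
  \<^term>\<open>Pi\<^sub>M {1..n} (\<lambda>_. lborel :: real measure)\<close> the \<open>n\<close>-dimensional Lebesgue measure.
\<close>

definition std_simplex :: "nat \<Rightarrow> real \<Rightarrow> (nat \<Rightarrow> real) set" where
  "std_simplex n u = {\<theta> \<in> {1..n} \<rightarrow>\<^sub>E UNIV. (\<Sum>i=1..n. \<theta> i) = u \<and> (\<forall>i\<in>{1..n}. 0 \<le> \<theta> i)}"

text \<open>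
  The right prism of height 1 over a subset of a hyperplane \<open>\<theta>\<^sub>1 + \<dots> + \<theta>\<^sub>n = u\<close>: the set is moved along
  the unit normal vector \<open>(1, \<dots>, 1) / sqrt n\<close> of that hyperplane.
\<close>

definition unit_prism :: "nat \<Rightarrow> (nat \<Rightarrow> real) set \<Rightarrow> (nat \<Rightarrow> real) set" where
  "unit_prism n C = (\<lambda>(\<theta>, t). \<lambda>i\<in>{1..n}. \<theta> i + t * (1 / sqrt (real n))) ` (C \<times> {0..1})"

text \<open>
  The \<open>(n - 1)\<close>-dimensional volume on such a hyperplane, i.e. its Euclidean Lebesgue measure. In
  orthonormal coordinates whose last axis is the normal, the \<open>n\<close>-dimensional Lebesgue measure is the
  product of this measure with the length along the normal, so the prism of height 1 over \<open>C\<close> has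
  exactly the volume of \<open>C\<close>. It is only meaningful for subsets of a hyperplane \<open>\<theta>\<^sub>1 + \<dots> + \<theta>\<^sub>n = u\<close>.
  The lemma \<open>simplex_vol_eq_graph\<close> below confirms that it agrees with the surface area formula for
  the graph \<open>\<theta>\<^sub>n = u - \<theta>\<^sub>1 - \<dots> - \<theta>\<^bsub>n-1\<^esub>\<close>, whose area element is \<open>sqrt n\<close>.
\<close>

definition simplex_vol :: "nat \<Rightarrow> (nat \<Rightarrow> real) set \<Rightarrow> real" where
  "simplex_vol n C = measure (Pi\<^sub>M {1..n} (\<lambda>_. lborel)) (unit_prism n C)"

definition uniform_on_simplex ::
    "'a measure \<Rightarrow> nat \<Rightarrow> real \<Rightarrow> ('a \<Rightarrow> nat \<Rightarrow> real) \<Rightarrow> bool" where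
  "uniform_on_simplex M n u \<Theta> \<longleftrightarrow>
     \<Theta> \<in> measurable M (Pi\<^sub>M {1..n} (\<lambda>_. borel)) \<and>
     (\<forall>C \<in> sets (Pi\<^sub>M {1..n} (\<lambda>_. borel)). C \<subseteq> std_simplex n u \<longrightarrow>
        measure M {\<omega> \<in> space M. \<Theta> \<omega> \<in> C} = simplex_vol n C / simplex_vol n (std_simplex n u))"

definition hr_le :: "nat \<Rightarrow> (nat \<Rightarrow> real) \<Rightarrow> (nat \<Rightarrow> real) \<Rightarrow> bool" where
  "hr_le n \<theta> \<theta>' \<longleftrightarrow> (\<forall>i j. 1 \<le> i \<and> i \<le> j \<and> j \<le> n \<longrightarrow>
     (\<Sum>k=i..n. \<theta> k) * (\<Sum>k=j..n. \<theta>' k) \<ge> (\<Sum>k=j..n. \<theta> k) * (\<Sum>k=i..n. \<theta>' k))"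

interpretation lborel_product: product_sigma_finite "\<lambda>_::nat. lborel :: real measure"
  by standard

lemma nn_integral_lborel_PiM_shift:
  fixes I :: "nat set" and f :: "(nat \<Rightarrow> real) \<Rightarrow> ennreal"
  assumes I: "finite I" and f [measurable]: "f \<in> borel_measurable (Pi\<^sub>M I (\<lambda>_. lborel))"
  shows "(\<integral>\<^sup>+x. f x \<partial>Pi\<^sub>M I (\<lambda>_. lborel)) = (\<integral>\<^sup>+x. f (\<lambda>i\<in>I. x i + c) \<partial>Pi\<^sub>M I (\<lambda>_. lborel))"
proof -
  let ?M = "Pi\<^sub>M I (\<lambda>_. lborel) :: (nat \<Rightarrow> real) measure"
  let ?T = "\<lambda>x. \<lambda>i\<in>I. x i + c :: real"
  have T [measurable]: "?T \<in> measurable ?M ?M"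
    by measurable
  have "distr ?M ?M ?T = ?M"
  proof (rule lborel_product.PiM_eqI[OF I])
    fix A :: "nat \<Rightarrow> real set" assume A: "\<And>i. i \<in> I \<Longrightarrow> A i \<in> sets lborel"
    have [measurable]: "Pi\<^sub>E I A \<in> sets ?M"
      using A I by (intro sets_PiM_I_finite) auto
    have "emeasure (distr ?M ?M ?T) (Pi\<^sub>E I A) = emeasure ?M (?T -` Pi\<^sub>E I A \<inter> space ?M)"
      by (rule emeasure_distr) auto
    also have "?T -` Pi\<^sub>E I A \<inter> space ?M = Pi\<^sub>E I (\<lambda>i. (\<lambda>y. c + y) -` A i)"
      by (auto simp: space_PiM PiE_def Pi_def add.commute extensional_def)
    also have "emeasure ?M \<dots> = (\<Prod>i\<in>I. emeasure lborel ((\<lambda>y. c + y) -` A i))"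
      using A I by (intro lborel_product.emeasure_PiM) (auto intro!: measurable_sets_borel[where M=borel])
    also have "\<dots> = (\<Prod>i\<in>I. emeasure lborel (A i))"
    proof (rule prod.cong)
      fix i assume i: "i \<in> I"
      have "emeasure lborel (A i) = emeasure (distr lborel borel ((+) c)) (A i)"
        by (simp add: lborel_distr_plus)
      also have "\<dots> = emeasure lborel ((\<lambda>y. c + y) -` A i)"
        using A[OF i] by (subst emeasure_distr) auto
      finally show "emeasure lborel ((\<lambda>y. c + y) -` A i) = emeasure lborel (A i)" ..
    qed simp
    finally show "emeasure (distr ?M ?M ?T) (Pi\<^sub>E I A) = (\<Prod>i\<in>I. emeasure lborel (A i))" .
  qed simp
  then have "(\<integral>\<^sup>+x. f x \<partial>?M) = (\<integral>\<^sup>+x. f x \<partial>distr ?M ?M ?T)"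
    by simp
  also have "\<dots> = (\<integral>\<^sup>+x. f (?T x) \<partial>?M)"
    by (rule nn_integral_distr) auto
  finally show ?thesis .
qed

lemma unit_prism_eq:
  assumes n: "1 \<le> n" and C: "C \<subseteq> std_simplex n u"
  shows "unit_prism n C = {x \<in> {1..n} \<rightarrow>\<^sub>E UNIV. (\<Sum>i=1..n. x i) \<in> {u..u + sqrt n} \<and>
    (\<lambda>i\<in>{1..n}. x i - ((\<Sum>i=1..n. x i) - u) / n) \<in> C}" (is "_ = ?R")
proof (intro set_eqI iffI)
  fix x assume "x \<in> unit_prism n C"
  then obtain \<theta> t where *: "\<theta> \<in> C" "0 \<le> t" "t \<le> 1" and x: "x = (\<lambda>i\<in>{1..n}. \<theta> i + t * (1 / sqrt n))"
    by (auto simp: unit_prism_def)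
  have \<theta>: "\<theta> \<in> {1..n} \<rightarrow>\<^sub>E UNIV" "(\<Sum>i=1..n. \<theta> i) = u"
    using * C by (auto simp: std_simplex_def)
  have "real n * (t * (1 / sqrt n)) = t * (real n / sqrt n)"
    by simp
  also have "real n / sqrt n = sqrt n"
    by (rule real_div_sqrt) simp
  finally have s: "(\<Sum>i=1..n. x i) = u + t * sqrt n"
    using \<theta> by (simp add: x sum.distrib)
  have "(\<lambda>i\<in>{1..n}. x i - ((\<Sum>i=1..n. x i) - u) / n) = \<theta>"
  proof
    fix i
    have "t * (1 / sqrt n) = t * sqrt n / n"
      using n by (simp add: real_div_sqrt field_simps)
    then show "(\<lambda>i\<in>{1..n}. x i - ((\<Sum>i=1..n. x i) - u) / n) i = \<theta> i"
      using \<theta>(1) unfolding s by (auto simp: x PiE_def extensional_def)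
  qed
  moreover have "t * sqrt n \<le> 1 * sqrt n"
    using * by (intro mult_right_mono) auto
  ultimately show "x \<in> ?R"
    using * s x by (auto intro: restrict_PiE)
next
  fix x assume x: "x \<in> ?R"
  let ?s = "\<Sum>i=1..n. x i"
  let ?\<theta> = "\<lambda>i\<in>{1..n}. x i - (?s - u) / n" and ?t = "(?s - u) / sqrt n"
  have "?\<theta> \<in> C" "?t \<in> {0..1}"
    using x n by (auto simp: field_simps)
  moreover have "x = (\<lambda>i\<in>{1..n}. ?\<theta> i + ?t * (1 / sqrt n))"
    using x n by (auto simp: fun_eq_iff PiE_def extensional_def)
  ultimately show "x \<in> unit_prism n C"
    unfolding unit_prism_def by (intro image_eqI[of _ _ "(?\<theta>, ?t)"]) auto
qed

lemma simplex_vol_eq_graph: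
  assumes n: "1 \<le> n" and C: "C \<in> sets (Pi\<^sub>M {1..n} (\<lambda>_. borel))" "C \<subseteq> std_simplex n u"
  shows "simplex_vol n C =
    sqrt n * measure (Pi\<^sub>M {1..<n} (\<lambda>_. lborel)) ((\<lambda>\<theta>. restrict \<theta> {1..<n}) ` C)"
proof -
  let ?I = "{1..<n}"
  let ?L = "Pi\<^sub>M ?I (\<lambda>_. lborel) :: (nat \<Rightarrow> real) measure"
  let ?N = "Pi\<^sub>M {1..n} (\<lambda>_. lborel) :: (nat \<Rightarrow> real) measure"
  let ?P = "unit_prism n C"
  let ?S = "\<lambda>x. \<Sum>i\<in>?I. x i :: real"
  have In: "insert n ?I = {1..n}"
    using n by auto
  have Cs [measurable]: "C \<in> sets ?N"
    using C(1) by (simp cong: sets_PiM_cong)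
  have "?P = {x \<in> space ?N. (\<Sum>i=1..n. x i) \<in> {u..u + sqrt n} \<and>
      (\<lambda>i\<in>{1..n}. x i - ((\<Sum>i=1..n. x i) - u) / n) \<in> C}"
    unfolding unit_prism_eq[OF n C(2)] by (simp add: space_PiM)
  also have "\<dots> \<in> sets ?N"
    by measurable
  finally have P [measurable]: "?P \<in> sets ?N" .
  have upd [measurable]: "(\<lambda>(x, y). x(n := y)) \<in> measurable (?L \<Otimes>\<^sub>M lborel) ?N"
    using measurable_add_dim[of n ?I "\<lambda>_. lborel :: real measure"] by (simp only: In)
  define g where "g x = x(n := u - ?S x)" for x
  have upd2: "(\<lambda>p. (f p)(n := h p)) \<in> measurable K ?N"
    if "f \<in> measurable K ?L" "h \<in> borel_measurable K" for K :: "'z measure" and f h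
    using measurable_compose[OF measurable_Pair[OF that(1), of h lborel] upd] that(2) by simp
  have g [measurable]: "g \<in> measurable ?L ?N"
    unfolding g_def by (intro upd2) measurable
  define K where "K = emeasure ?L (g -` C \<inter> space ?L)"
  have ind: "indicator ?P (x(n := s - ?S x)) =
      (indicator {u..u + sqrt n} s * indicator C (g (\<lambda>i\<in>?I. x i + - ((s - u) / n))) :: ennreal)"
    if x: "x \<in> space ?L" for x and s :: real
  proof -
    let ?y = "x(n := s - ?S x)"
    have y: "?y \<in> {1..n} \<rightarrow>\<^sub>E UNIV"
      using x n by (auto simp: space_PiM PiE_def extensional_def)
    have s: "(\<Sum>i=1..n. ?y i) = s"
      unfolding In[symmetric] by (subst sum.insert) (auto intro!: sum.cong simp: algebra_simps)
    have S: "?S (\<lambda>i\<in>?I. x i + - ((s - u) / n)) = ?S x - (real n - 1) * ((s - u) / n)"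
      using n by (simp add: sum_subtractf of_nat_diff)
    have "u - (?S x - (real n - 1) * ((s - u) / n)) = s - ?S x - (s - u) / n"
      using n by (simp add: field_simps)
    then have "(\<lambda>i\<in>{1..n}. ?y i - (s - u) / n) = g (\<lambda>i\<in>?I. x i + - ((s - u) / n))"
      unfolding g_def S using n by (auto simp: fun_eq_iff)
    then show ?thesis
      unfolding unit_prism_eq[OF n C(2)] using y s by (auto simp: indicator_def)
  qed
  have "emeasure ?N ?P = (\<integral>\<^sup>+x. indicator ?P x \<partial>?N)"
    by (rule nn_integral_indicator[OF P, symmetric])
  also have "\<dots> = (\<integral>\<^sup>+x. (\<integral>\<^sup>+y. indicator ?P (x(n := y)) \<partial>lborel) \<partial>?L)"
    using lborel_product.product_nn_integral_insert[of ?I n "indicator ?P"] borel_measurable_indicator[OF P]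
    unfolding In by simp
  also have "\<dots> = (\<integral>\<^sup>+x. (\<integral>\<^sup>+s. indicator ?P (x(n := s - ?S x)) \<partial>lborel) \<partial>?L)"
  proof (rule nn_integral_cong)
    fix x assume x: "x \<in> space ?L"
    have m: "(\<lambda>y. indicator ?P (x(n := y)) :: ennreal) \<in> borel_measurable borel"
      using x by (intro measurable_compose[OF upd2 borel_measurable_indicator[OF P]]) auto
    show "(\<integral>\<^sup>+y. indicator ?P (x(n := y)) \<partial>lborel) =
      (\<integral>\<^sup>+s. indicator ?P (x(n := s - ?S x)) \<partial>lborel)"
      using nn_integral_real_affine[OF m, of 1 "- ?S x"] by simp
  qed
  also have "\<dots> = (\<integral>\<^sup>+x. (\<integral>\<^sup>+s. indicator {u..u + sqrt n} s *
      indicator C (g (\<lambda>i\<in>?I. x i + - ((s - u) / n))) \<partial>lborel) \<partial>?L)"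
    by (intro nn_integral_cong ind)
  also have "\<dots> = (\<integral>\<^sup>+s. (\<integral>\<^sup>+x. indicator {u..u + sqrt n} s *
      indicator C (g (\<lambda>i\<in>?I. x i + - ((s - u) / n))) \<partial>?L) \<partial>lborel)"
  proof (rule pair_sigma_finite.Fubini')
    show "pair_sigma_finite lborel ?L"
      by (intro pair_sigma_finite.intro lborel_product.sigma_finite sigma_finite_lborel) auto
  qed measurable
  also have "\<dots> = (\<integral>\<^sup>+s. indicator {u..u + sqrt n} s * K \<partial>lborel)"
  proof (rule nn_integral_cong)
    fix s :: real
    have m: "(\<lambda>x. indicator C (g (\<lambda>i\<in>?I. x i + - ((s - u) / n))) :: ennreal) \<in> borel_measurable ?L"
      by measurable
    have "(\<integral>\<^sup>+x. indicator C (g (\<lambda>i\<in>?I. x i + - ((s - u) / n))) \<partial>?L) =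
        (\<integral>\<^sup>+x. indicator C (g x) \<partial>?L)"
      by (rule nn_integral_lborel_PiM_shift[symmetric]) (simp, measurable)
    also have "\<dots> = (\<integral>\<^sup>+x. indicator (g -` C \<inter> space ?L) x \<partial>?L)"
      by (intro nn_integral_cong) (auto simp: indicator_def)
    also have "\<dots> = K"
      unfolding K_def by (rule nn_integral_indicator) measurable
    finally show "(\<integral>\<^sup>+x. indicator {u..u + sqrt n} s *
        indicator C (g (\<lambda>i\<in>?I. x i + - ((s - u) / n))) \<partial>?L) = indicator {u..u + sqrt n} s * K"
      by (simp only: nn_integral_cmult[OF m])
  qed
  also have "\<dots> = ennreal (sqrt n) * K"
    by (subst nn_integral_multc) auto
  finally have "emeasure ?N ?P = ennreal (sqrt n) * K" .
  moreover have "g -` C \<inter> space ?L = (\<lambda>\<theta>. restrict \<theta> ?I) ` C"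
  proof (intro set_eqI iffI)
    fix x assume x: "x \<in> g -` C \<inter> space ?L"
    have "x = restrict (g x) ?I"
      using x by (auto simp: g_def fun_eq_iff space_PiM PiE_def extensional_def)
    then show "x \<in> (\<lambda>\<theta>. restrict \<theta> ?I) ` C"
      using x by blast
  next
    fix x assume "x \<in> (\<lambda>\<theta>. restrict \<theta> ?I) ` C"
    then obtain \<theta> where \<theta>: "\<theta> \<in> C" "x = restrict \<theta> ?I"
      by auto
    have *: "\<theta> \<in> {1..n} \<rightarrow>\<^sub>E UNIV" "(\<Sum>i\<in>insert n ?I. \<theta> i) = u"
      using \<theta> C(2) unfolding In by (auto simp: std_simplex_def)
    then have "\<theta> n = u - ?S \<theta>"
      by (subst (asm) sum.insert) auto
    then have "g x = \<theta>"
      using * by (auto simp: g_def \<theta> fun_eq_iff PiE_def extensional_def)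
    then show "x \<in> g -` C \<inter> space ?L"
      using \<theta> by (auto simp: space_PiM)
  qed
  ultimately show ?thesis
    by (simp add: simplex_vol_def K_def measure_def enn2real_mult)
qed

end

theory Submission
  imports Defs
begin

text \<open>
  Write \<open>T\<^sub>j = \<theta>\<^sub>j + \<dots> + \<theta>\<^sub>n\<close> and \<open>T'\<^sub>j\<close> for the tail sums of the two vectors. As \<open>T\<^sub>1 = u\<close>, a point
  of the simplex is the same as a chain \<open>u \<ge> T\<^sub>2 \<ge> \<dots> \<ge> T\<^sub>n \<ge> 0\<close>, and the uniform distribution is the
  normalised Lebesgue measure on these chains. The order is a condition on consecutive ratios of
  tails, \<open>T\<^sub>j / T\<^bsub>j-1\<^esub> \<le> T'\<^sub>j / T'\<^bsub>j-1\<^esub>\<close> for \<open>2 \<le> j \<le> n\<close>. Under the uniform distribution these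
  \<open>n - 1\<close> ratios are independent with continuous laws, so by symmetry between \<open>\<theta>\<close> and \<open>\<theta>'\<close> each
  condition holds with probability \<open>1/2\<close>, independently of the others.

  The independence appears below in integrated form. Let \<open>V\<^sub>m(a, b)\<close> be the volume of the pairs of
  chains of length \<open>m\<close> that start at \<open>a\<close> and \<open>b\<close> and satisfy the conditions on the ratios. Splitting
  off the first step gives
  \<open>V\<^bsub>m+1\<^esub>(a, b) = \<integral>\<integral> V\<^sub>m(a - t, b - s) ds dt\<close> over \<open>0 \<le> t \<le> a\<close>, \<open>0 \<le> s \<le> b\<close>, \<open>(a - t) b \<le> a (b - s)\<close>.
  As \<open>V\<^sub>m\<close> is homogeneous in \<open>a\<close> and in \<open>b\<close>, the integral is elementary (\<open>nn_integral_first_step\<close>),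
  and \<open>V\<^sub>m(a, b) = (a\<^sup>m / m!) (b\<^sup>m / m!) / 2\<^sup>m\<close> (\<open>nn_integral_survival_ordered\<close>). Without the conditions
  the volume is \<open>(a\<^sup>m / m!) (b\<^sup>m / m!)\<close>, and the quotient for \<open>m = n - 1\<close>, \<open>a = b = u\<close> is the probability.

  Two further facts link this to random vectors. The order restricted to consecutive indices
  implies the full one even if some tails vanish (\<open>hr_le_iff_adjacent\<close>). The law of a uniform vector
  is the image of the uniform law on the first \<open>n - 1\<close> coordinates under the map that fills in
  the last coordinate (\<open>distr_uniform_on_simplex\<close>), which follows from the area formula
  \<open>simplex_vol_eq_graph\<close>.
\<close>

section \<open>Pairs of vectors with ordered tail ratios\<close>

text \<open>
  The parameters \<open>a\<close> and \<open>b\<close> are the masses that remain for the coordinates from \<open>k\<close> on, that is the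
  tails \<open>T\<^sub>k\<close> and \<open>T'\<^sub>k\<close>; the next \<open>m\<close> coordinates are subtracted one at a time. The product form of the
  ratio condition makes sense for vanishing tails as well, and the recursion mirrors the iterated
  integral that computes the volume of the region.
\<close>

primrec survival_ordered :: "nat \<Rightarrow> nat \<Rightarrow> real \<Rightarrow> real \<Rightarrow> (nat \<Rightarrow> real) \<Rightarrow> (nat \<Rightarrow> real) \<Rightarrow> bool" where
  "survival_ordered 0 k a b x y \<longleftrightarrow> True"
| "survival_ordered (Suc m) k a b x y \<longleftrightarrow>
     x k \<in> {0..a} \<and> y k \<in> {0..b} \<and> (a - x k) * b \<le> a * (b - y k) \<and>
     survival_ordered m (Suc k) (a - x k) (b - y k) x y"

lemma survival_ordered_cong:
  assumes "\<And>i. i \<in> {k..<k + m} \<Longrightarrow> x i = x' i" "\<And>i. i \<in> {k..<k + m} \<Longrightarrow> y i = y' i"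
  shows "survival_ordered m k a b x y \<longleftrightarrow> survival_ordered m k a b x' y'"
  using assms
proof (induction m arbitrary: k a b)
  case (Suc m)
  have "x k = x' k" "y k = y' k" using Suc.prems by auto
  moreover have "survival_ordered m (Suc k) (a - x k) (b - y k) x y \<longleftrightarrow>
    survival_ordered m (Suc k) (a - x k) (b - y k) x' y'"
    by (rule Suc.IH) (use Suc.prems in auto)
  ultimately show ?case by simp
qed simp

text \<open>
  The masses \<open>f\<close> and \<open>g\<close> may depend on the point, since they do so after the first step of the
  recursion and inside the iterated integrals.
\<close>

lemma pred_survival_ordered:
  assumes "f \<in> borel_measurable K" "g \<in> borel_measurable K"
    and "\<And>i. i \<in> {k..<k + m} \<Longrightarrow> (\<lambda>z. X z i) \<in> borel_measurable K"
    and "\<And>i. i \<in> {k..<k + m} \<Longrightarrow> (\<lambda>z. Y z i) \<in> borel_measurable K"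
  shows "Measurable.pred K (\<lambda>z. survival_ordered m k (f z) (g z) (X z) (Y z))"
  using assms
proof (induction m arbitrary: k f g)
  case (Suc m)
  have [measurable]: "f \<in> borel_measurable K" "g \<in> borel_measurable K" by fact+
  have [measurable]: "(\<lambda>z. X z k) \<in> borel_measurable K" "(\<lambda>z. Y z k) \<in> borel_measurable K"
    using Suc.prems by auto
  have [measurable]: "Measurable.pred K (\<lambda>z. survival_ordered m (Suc k) (f z - X z k) (g z - Y z k) (X z) (Y z))"
    by (rule Suc.IH) (use Suc.prems in auto)
  show ?case
    by simp measurable
qed simp

lemma nn_integral_power_Icc:
  fixes b c :: real
  assumes "0 \<le> c" "c \<le> b"
  shows "(\<integral>\<^sup>+s. ennreal ((b - s) ^ m) * indicator {0..c} s \<partial>lborel) =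
    ennreal ((b ^ Suc m - (b - c) ^ Suc m) / Suc m)"
proof -
  have "((\<lambda>s. - ((b - s) ^ Suc m / Suc m)) has_real_derivative (b - s) ^ m) (at s)" for s
    by (rule derivative_eq_intros refl | simp)+
  then have "(\<integral>\<^sup>+s\<in>{0..c}. ennreal ((b - s) ^ m) \<partial>lborel) =
      ennreal (- ((b - c) ^ Suc m / Suc m) - (- ((b - 0) ^ Suc m / Suc m)))"
    using assms by (intro nn_integral_FTC_Icc) auto
  then show ?thesis by (simp add: diff_divide_distrib)
qed


text \<open>
  For \<open>a > 0\<close> the condition reads \<open>s \<le> b t / a\<close>. The inner integral then leaves
  \<open>(a - t)\<^sup>m - (a - t)\<^bsup>2m+1\<^esup> / a\<^bsup>m+1\<^esup>\<close> times constants, and the integral of the second term over \<open>[0, a]\<close>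
  is half that of the first: this is where the factor \<open>1/2\<close> arises.
\<close>

lemma nn_integral_first_step:
  fixes a b c :: real
  assumes a: "0 \<le> a" and b: "0 \<le> b" and c: "0 \<le> c"
  defines "A \<equiv> \<lambda>t s. t \<in> {0..a} \<and> s \<in> {0..b} \<and> (a - t) * b \<le> a * (b - s)"
  shows "(\<integral>\<^sup>+t. \<integral>\<^sup>+s. of_bool (A t s) * ennreal (((a - t) * (b - s)) ^ m * c) \<partial>lborel \<partial>lborel) =
    ennreal ((a * b) ^ Suc m / (2 * (Suc m)\<^sup>2) * c)"
proof (cases "a = 0")
  case True
  \<comment> \<open>The outer integral runs over the single point 0.\<close>
  have "AE t in lborel. t \<noteq> (0 :: real)" by (rule AE_lborel_singleton)
  then have "AE t in lborel. (\<integral>\<^sup>+s. of_bool (A t s) * ennreal (((a - t) * (b - s)) ^ m * c) \<partial>lborel) = 0"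
    by eventually_elim (use True in \<open>auto simp: A_def\<close>)
  then have "(\<integral>\<^sup>+t. \<integral>\<^sup>+s. of_bool (A t s) * ennreal (((a - t) * (b - s)) ^ m * c) \<partial>lborel \<partial>lborel)
      = (\<integral>\<^sup>+t. 0 \<partial>(lborel :: real measure))"
    by (rule nn_integral_cong_AE)
  then show ?thesis using True by simp
next
  case False
  with a have a: "0 < a" by simp
  define B where "B = b ^ Suc m / Suc m"
  have B: "0 \<le> B" using b by (simp add: B_def)
  have inner: "(\<integral>\<^sup>+s. of_bool (A t s) * ennreal (((a - t) * (b - s)) ^ m * c) \<partial>lborel) =
      ennreal (c * B * ((a - t) ^ m - (a - t) ^ (2 * m + 1) / a ^ Suc m)) * indicator {0..a} t" for t
  proof (cases "t \<in> {0..a}")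
    case t: True
    have le: "b * t / a \<le> b" using t a b by (simp add: pos_divide_le_eq mult_left_mono)
    have ge: "0 \<le> b * t / a" using t a b by simp
    have iff: "A t s \<longleftrightarrow> s \<in> {0..b * t / a}" for s
    proof -
      have "(a - t) * b \<le> a * (b - s) \<longleftrightarrow> s * a \<le> b * t"
        by (simp add: algebra_simps)
      also have "\<dots> \<longleftrightarrow> s \<le> b * t / a"
        using a by (simp add: pos_le_divide_eq)
      finally show ?thesis unfolding A_def using t le by auto
    qed
    have "(\<integral>\<^sup>+s. of_bool (A t s) * ennreal (((a - t) * (b - s)) ^ m * c) \<partial>lborel) =
        (\<integral>\<^sup>+s. ennreal ((a - t) ^ m * c) * (ennreal ((b - s) ^ m) * indicator {0..b * t / a} s) \<partial>lborel)"
    proof (intro nn_integral_cong)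
      fix s
      show "of_bool (A t s) * ennreal (((a - t) * (b - s)) ^ m * c) =
          ennreal ((a - t) ^ m * c) * (ennreal ((b - s) ^ m) * indicator {0..b * t / a} s)"
      proof (cases "A t s")
        case True
        have "ennreal (((a - t) * (b - s)) ^ m * c) = ennreal ((a - t) ^ m * c * (b - s) ^ m)"
          by (simp add: power_mult_distrib mult_ac)
        also have "\<dots> = ennreal ((a - t) ^ m * c) * ennreal ((b - s) ^ m)"
          using t c by (intro ennreal_mult') auto
        finally show ?thesis using True iff by simp
      next
        case False then show ?thesis using iff by simp
      qed
    qed
    also have "\<dots> = ennreal ((a - t) ^ m * c) * ennreal ((b ^ Suc m - (b - b * t / a) ^ Suc m) / Suc m)"
      by (subst nn_integral_cmult) (use nn_integral_power_Icc[OF ge le] in auto)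
    also have "\<dots> = ennreal ((a - t) ^ m * c * ((b ^ Suc m - (b - b * t / a) ^ Suc m) / Suc m))"
      using t c by (intro ennreal_mult'[symmetric]) auto
    also have "b - b * t / a = b * ((a - t) / a)" using a by (simp add: field_simps)
    also have "(a - t) ^ m * c * ((b ^ Suc m - (b * ((a - t) / a)) ^ Suc m) / Suc m) =
        c * B * ((a - t) ^ m - (a - t) ^ m * (a - t) ^ Suc m / a ^ Suc m)"
    proof -
      have "p * c * ((b' - b' * (q / d)) / r) = c * (b' / r) * (p - p * q / d)" for p b' q d r :: real
        by (simp add: algebra_simps diff_divide_distrib)
      then show ?thesis unfolding B_def power_mult_distrib power_divide by blast
    qed
    also have "(a - t) ^ m * (a - t) ^ Suc m = (a - t) ^ (2 * m + 1)"
      unfolding power_add[symmetric] by (simp add: mult_2)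
    finally show ?thesis using t by simp
  next
    case False then show ?thesis by (auto simp: A_def)
  qed
  define F where "F t = c * B *
      ((a - t) ^ Suc (2 * m + 1) / (real (Suc (2 * m + 1)) * a ^ Suc m) - (a - t) ^ Suc m / (real (Suc m) * 1))" for t
  have "(F has_real_derivative c * B * ((a - t) ^ m - (a - t) ^ (2 * m + 1) / a ^ Suc m)) (at t)" for t
  proof -
    have pw: "((\<lambda>t. (a - t) ^ Suc k / (real (Suc k) * d)) has_real_derivative - ((a - t) ^ k / d)) (at t)" for k and d :: real
    proof -
      have "((\<lambda>t. (a - t) ^ Suc k) has_real_derivative - (Suc k * (a - t) ^ k)) (at t)"
        by (rule derivative_eq_intros refl | simp)+
      from DERIV_cdivide[OF this, of "real (Suc k) * d"] show ?thesis
        by (rule DERIV_cong) simp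
    qed
    have "(F has_real_derivative c * B * (- ((a - t) ^ (2 * m + 1) / a ^ Suc m) - - ((a - t) ^ m / 1))) (at t)"
      unfolding F_def by (intro DERIV_cmult DERIV_diff pw)
    then show ?thesis by (rule DERIV_cong) simp
  qed
  moreover have "0 \<le> c * B * ((a - t) ^ m - (a - t) ^ (2 * m + 1) / a ^ Suc m)" if "0 \<le> t" "t \<le> a" for t
  proof -
    have "(a - t) ^ m * (a - t) ^ Suc m \<le> (a - t) ^ m * a ^ Suc m"
      using that by (intro mult_left_mono power_mono) auto
    also have "(a - t) ^ m * (a - t) ^ Suc m = (a - t) ^ (2 * m + 1)"
      unfolding power_add[symmetric] by (simp add: mult_2)
    finally have "(a - t) ^ (2 * m + 1) / a ^ Suc m \<le> (a - t) ^ m"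
      using a by (simp only: pos_divide_le_eq zero_less_power)
    then show ?thesis using B c by simp
  qed
  ultimately have "(\<integral>\<^sup>+t\<in>{0..a}. ennreal (c * B * ((a - t) ^ m - (a - t) ^ (2 * m + 1) / a ^ Suc m)) \<partial>lborel) =
      ennreal (F a - F 0)"
    using a by (intro nn_integral_FTC_Icc) auto
  also have "F a - F 0 = c * B * (a ^ Suc m / Suc m - a ^ (2 * m + 2) / ((2 * m + 2) * a ^ Suc m))"
    unfolding F_def by (simp add: right_diff_distrib)
  also have "a ^ (2 * m + 2) = a ^ Suc m * a ^ Suc m"
    unfolding power_add[symmetric] by (simp add: mult_2)
  also have "c * B * (a ^ Suc m / Suc m - a ^ Suc m * a ^ Suc m / ((2 * m + 2) * a ^ Suc m)) =
      (a * b) ^ Suc m / (2 * (Suc m)\<^sup>2) * c"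
  proof -
    have "c * (q / r) * (p / r - p * p / ((2 * r) * p)) = p * q / (2 * r\<^sup>2) * c"
      if "p \<noteq> 0" "r \<noteq> 0" for p q r :: real
      using that by (simp add: field_simps power2_eq_square)
    from this[of "a ^ Suc m" "Suc m" "b ^ Suc m"] show ?thesis
      using a unfolding B_def power_mult_distrib by (simp add: algebra_simps)
  qed
  finally show ?thesis unfolding inner .
qed

text \<open>
  Induction on the number of coordinates: Tonelli brings the first coordinates of both vectors to
  the front, the induction hypothesis gives the volume of the remaining region as a function of the
  masses left over, and \<open>nn_integral_first_step\<close> integrates it.
\<close>

lemma nn_integral_survival_ordered:
  fixes a b :: real
  assumes "0 \<le> a" "0 \<le> b"
  shows "(\<integral>\<^sup>+x. \<integral>\<^sup>+y. of_bool (survival_ordered m k a b x y)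
      \<partial>Pi\<^sub>M {k..<k + m} (\<lambda>_. lborel) \<partial>Pi\<^sub>M {k..<k + m} (\<lambda>_. lborel)) =
    ennreal ((a * b) ^ m / (2 ^ m * (fact m)\<^sup>2))"
  using assms
proof (induction m arbitrary: k a b)
  case 0
  then show ?case by (simp add: PiM_empty nn_integral_count_space_finite)
next
  case (Suc m)
  define J where "J = {Suc k..<Suc k + m}"
  let ?L = "Pi\<^sub>M J (\<lambda>_. lborel) :: (nat \<Rightarrow> real) measure"
  let ?K = "Pi\<^sub>M (insert k J) (\<lambda>_. lborel) :: (nat \<Rightarrow> real) measure"
  define A where "A t s \<longleftrightarrow> t \<in> {0..a} \<and> s \<in> {0..b} \<and> (a - t) * b \<le> a * (b - s)" for t s
  let ?R = "\<lambda>x y. of_bool (survival_ordered (Suc m) k a b x y) :: ennreal"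
  let ?R' = "\<lambda>t s x y. of_bool (survival_ordered m (Suc k) (a - t) (b - s) x y) :: ennreal"
  have ins: "{k..<k + Suc m} = insert k J" by (auto simp: J_def)
  have J: "finite J" "k \<notin> J" by (auto simp: J_def)
  have sf: "sigma_finite_measure ?L" "sigma_finite_measure ?K"
    using J by (auto intro!: lborel_product.sigma_finite)
  have comp: "(\<lambda>z. h z i) \<in> borel_measurable Z"
    if "h \<in> measurable Z (Pi\<^sub>M I (\<lambda>_. lborel))" "i \<in> I"
    for h :: "'z \<Rightarrow> nat \<Rightarrow> real" and Z I i
    using measurable_compose[OF that(1) measurable_component_singleton[OF that(2)]] by simp
  have R [measurable]: "(\<lambda>z. ?R (f z) (g z)) \<in> borel_measurable Z"
    if "f \<in> measurable Z ?K" "g \<in> measurable Z ?K" for Z :: "'z measure" and f g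
  proof -
    have [measurable]: "Measurable.pred Z (\<lambda>z. survival_ordered (Suc m) k a b (f z) (g z))"
      using that comp ins by (intro pred_survival_ordered) auto
    show ?thesis unfolding of_bool_def by measurable
  qed
  have R' [measurable]: "(\<lambda>z. ?R' (p z) (q z) (f z) (g z)) \<in> borel_measurable Z"
    if "f \<in> measurable Z ?L" "g \<in> measurable Z ?L" and [measurable]: "p \<in> borel_measurable Z" "q \<in> borel_measurable Z"
    for Z :: "'z measure" and f g p q
  proof -
    have [measurable]: "Measurable.pred Z (\<lambda>z. survival_ordered m (Suc k) (a - p z) (b - q z) (f z) (g z))"
      by (intro pred_survival_ordered) (use comp[OF that(1)] comp[OF that(2)] that(3,4) in \<open>auto simp: J_def\<close>)
    show ?thesis unfolding of_bool_def by measurable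
  qed
  have split: "?R (x(k := t)) (y(k := s)) = of_bool (A t s) * ?R' t s x y" for x y t s
    unfolding of_bool_conj[symmetric]
    by (intro arg_cong[of _ _ of_bool])
       (use survival_ordered_cong[of "Suc k" m "x(k := t)" x "y(k := s)" y "a - t" "b - s"] in \<open>auto simp: A_def\<close>)
  have "(\<integral>\<^sup>+x. \<integral>\<^sup>+y. ?R x y \<partial>?K \<partial>?K) = (\<integral>\<^sup>+t. \<integral>\<^sup>+x. \<integral>\<^sup>+y. ?R (x(k := t)) y \<partial>?K \<partial>?L \<partial>lborel)"
  proof (rule lborel_product.product_nn_integral_insert_rev[OF J])
    show "(\<lambda>x. \<integral>\<^sup>+y. ?R x y \<partial>?K) \<in> borel_measurable ?K"
      by (intro sigma_finite_measure.borel_measurable_nn_integral[OF sf(2)]) (unfold split_beta', rule R, auto)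
  qed
  also have "\<dots> = (\<integral>\<^sup>+t. \<integral>\<^sup>+x. \<integral>\<^sup>+s. \<integral>\<^sup>+y. ?R (x(k := t)) (y(k := s)) \<partial>?L \<partial>lborel \<partial>?L \<partial>lborel)"
  proof (intro nn_integral_cong lborel_product.product_nn_integral_insert_rev[OF J] R)
    fix t :: real and x assume "x \<in> space ?L"
    then have "x(k := t) \<in> space ?K" by (auto simp: space_PiM PiE_def extensional_def)
    then show "(\<lambda>_. x(k := t)) \<in> measurable ?K ?K" by simp
  qed auto
  also have "\<dots> = (\<integral>\<^sup>+t. \<integral>\<^sup>+s. \<integral>\<^sup>+x. \<integral>\<^sup>+y. of_bool (A t s) * ?R' t s x y \<partial>?L \<partial>?L \<partial>lborel \<partial>lborel)"
    unfolding split
  proof (intro nn_integral_cong pair_sigma_finite.Fubini')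
    show "pair_sigma_finite lborel ?L"
      using sf by (intro pair_sigma_finite.intro sigma_finite_lborel)
    fix t :: real
    show "(\<lambda>(s, x). \<integral>\<^sup>+y. of_bool (A t s) * ?R' t s x y \<partial>?L) \<in> borel_measurable (lborel \<Otimes>\<^sub>M ?L)"
    proof -
      have [measurable]: "(\<lambda>z. of_bool (A t (p z)) :: ennreal) \<in> borel_measurable Z"
        if [measurable]: "p \<in> borel_measurable Z" for Z :: "'z measure" and p
        unfolding of_bool_def A_def atLeastAtMost_iff by measurable
      show ?thesis
        unfolding split_beta'
        by (intro sigma_finite_measure.borel_measurable_nn_integral[OF sf(1)]) (simp add: split_beta')
    qed
  qed
  also have "\<dots> = (\<integral>\<^sup>+t. \<integral>\<^sup>+s. of_bool (A t s) * (\<integral>\<^sup>+x. \<integral>\<^sup>+y. ?R' t s x y \<partial>?L \<partial>?L) \<partial>lborel \<partial>lborel)"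
    by (intro nn_integral_cong) (simp add: of_bool_def)
  also have "\<dots> = (\<integral>\<^sup>+t. \<integral>\<^sup>+s. of_bool (A t s) *
      ennreal (((a - t) * (b - s)) ^ m * (1 / (2 ^ m * (fact m)\<^sup>2))) \<partial>lborel \<partial>lborel)"
    using Suc.IH[of "a - t" "b - s" "Suc k" for t s]
    by (intro nn_integral_cong) (auto simp: A_def J_def of_bool_def)
  also have "\<dots> = ennreal ((a * b) ^ Suc m / (2 * (Suc m)\<^sup>2) * (1 / (2 ^ m * (fact m)\<^sup>2)))"
    unfolding A_def by (rule nn_integral_first_step) (use Suc.prems in auto)
  also have "(a * b) ^ Suc m / (2 * (Suc m)\<^sup>2) * (1 / (2 ^ m * (fact m)\<^sup>2)) =
      (a * b) ^ Suc m / (2 ^ Suc m * (fact (Suc m))\<^sup>2)"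
    by (simp add: power_mult_distrib mult_ac)
  finally show ?case unfolding ins .
qed


section \<open>Reduction of the order to consecutive tails\<close>

text \<open>With the total masses as starting values, the masses left over are exactly the tail sums.\<close>

lemma survival_ordered_iff_adjacent:
  assumes "k + m = n" "\<forall>i\<in>{k..n}. 0 \<le> x i" "\<forall>i\<in>{k..n}. 0 \<le> y i"
  shows "survival_ordered m k (\<Sum>i=k..n. x i) (\<Sum>i=k..n. y i) x y \<longleftrightarrow>
    (\<forall>j\<in>{k..<n}. (\<Sum>i=Suc j..n. x i) * (\<Sum>i=j..n. y i) \<le> (\<Sum>i=j..n. x i) * (\<Sum>i=Suc j..n. y i))"
  using assms
proof (induction m arbitrary: k)
  case (Suc m)
  have k: "k < n" using Suc.prems by simp
  have peel: "(\<Sum>i=k..n. z i) - z k = (\<Sum>i=Suc k..n. z i)" for z :: "nat \<Rightarrow> real"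
    using k by (simp add: sum.atLeast_Suc_atMost)
  have le: "z k \<in> {0..\<Sum>i=k..n. z i}" if "\<forall>i\<in>{k..n}. 0 \<le> z i" for z :: "nat \<Rightarrow> real"
    using that k sum_nonneg[of "{Suc k..n}" z] peel[of z] by auto
  have "{k..<n} = insert k {Suc k..<n}" using k by auto
  then show ?case
    using Suc.IH[of "Suc k"] Suc.prems le[of x] le[of y] by (simp add: peel)
qed simp

text \<open>
  For positive tails the ratios multiply up along a chain of indices. A zero tail of \<open>x\<close> stays zero
  and makes the left side of the inequality vanish; a zero tail of \<open>y\<close> next to a positive tail of \<open>x\<close>
  forces, by the induction hypothesis, the earlier tail of \<open>y\<close> to be zero as well. So nonnegativity
  suffices and no null set has to be discarded.
\<close>

lemma hr_le_iff_adjacent: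
  assumes x: "\<forall>i\<in>{1..n}. 0 \<le> x i" and y: "\<forall>i\<in>{1..n}. 0 \<le> y i"
  shows "hr_le n x y \<longleftrightarrow>
    (\<forall>j\<in>{1..<n}. (\<Sum>i=Suc j..n. x i) * (\<Sum>i=j..n. y i) \<le> (\<Sum>i=j..n. x i) * (\<Sum>i=Suc j..n. y i))"
    (is "_ \<longleftrightarrow> (\<forall>j\<in>_. ?S (Suc j) * ?T j \<le> ?S j * ?T (Suc j))")
proof
  assume "hr_le n x y"
  then show "\<forall>j\<in>{1..<n}. ?S (Suc j) * ?T j \<le> ?S j * ?T (Suc j)"
    by (auto simp: hr_le_def)
next
  assume adj: "\<forall>j\<in>{1..<n}. ?S (Suc j) * ?T j \<le> ?S j * ?T (Suc j)"
  have nonneg: "0 \<le> ?S i" "0 \<le> ?T i" if "1 \<le> i" for i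
    using that x y by (auto intro!: sum_nonneg)
  have decr: "?S (Suc i) \<le> ?S i" if "1 \<le> i" for i
    using that x by (intro sum_mono2) auto
  have "?S j * ?T i \<le> ?S i * ?T j" if "1 \<le> i" "i \<le> j" "j \<le> n" for i j
    using that(2,3)
  proof (induction j rule: dec_induct)
    case (step j)
    have IH: "?S j * ?T i \<le> ?S i * ?T j" using step by simp
    have st: "?S (Suc j) * ?T j \<le> ?S j * ?T (Suc j)" using step that(1) adj by simp
    note nn = nonneg[OF that(1)] nonneg[of j] nonneg[of "Suc j"]
    have "1 \<le> j" using that(1) step(1) by simp
    then consider "?S j = 0" | "0 < ?S j" "?T j = 0" | "0 < ?S j" "0 < ?T j"
      using nonneg[of j] by linarith
    then show ?case
    proof cases
      case 1
      then have "?S (Suc j) = 0" using decr[of j] nonneg(1)[of "Suc j"] step that(1) by simp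
      then show ?thesis using nn by simp
    next
      case 2
      then have "?S j * ?T i \<le> 0" using IH by simp
      then have "?T i = 0" using 2 nn(2) by (simp add: mult_le_0_iff)
      then show ?thesis using nn by simp
    next
      case 3
      have "(?S j * ?T j) * (?S (Suc j) * ?T i) = (?S j * ?T i) * (?S (Suc j) * ?T j)" by simp
      also have "\<dots> \<le> (?S i * ?T j) * (?S j * ?T (Suc j))"
        using nn nonneg[of j] \<open>1 \<le> j\<close> by (intro mult_mono[OF IH st] mult_nonneg_nonneg) auto
      also have "\<dots> = (?S j * ?T j) * (?S i * ?T (Suc j))" by simp
      finally show ?thesis using 3 by (simp add: mult_le_cancel_left_pos)
    qed
  qed simp
  then show "hr_le n x y" by (auto simp: hr_le_def)
qed

section \<open>The uniform distribution in coordinates\<close>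

text \<open>The projection of the simplex to its first \<open>n - 1\<close> coordinates, a full-dimensional set.\<close>

definition corner :: "nat \<Rightarrow> real \<Rightarrow> (nat \<Rightarrow> real) set" where
  "corner n u = {x \<in> {1..<n} \<rightarrow>\<^sub>E UNIV. (\<forall>i\<in>{1..<n}. 0 \<le> x i) \<and> (\<Sum>i\<in>{1..<n}. x i) \<le> u}"

text \<open>On \<^const>\<open>corner\<close>, this is the inverse of the projection of the simplex.\<close>

definition lift_simplex :: "nat \<Rightarrow> real \<Rightarrow> (nat \<Rightarrow> real) \<Rightarrow> nat \<Rightarrow> real" where
  "lift_simplex n u x = x(n := u - (\<Sum>i\<in>{1..<n}. x i))"

lemma survival_ordered_imp_corner:
  assumes "survival_ordered m k a b x y" "0 \<le> a" "0 \<le> b"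
  shows "(\<forall>i\<in>{k..<k + m}. 0 \<le> x i \<and> 0 \<le> y i) \<and> (\<Sum>i\<in>{k..<k + m}. x i) \<le> a \<and> (\<Sum>i\<in>{k..<k + m}. y i) \<le> b"
  using assms
proof (induction m arbitrary: k a b)
  case (Suc m)
  have "{k..<k + Suc m} = insert k {Suc k..<Suc k + m}" by auto
  with Suc.IH[of "Suc k" "a - x k" "b - y k"] Suc.prems show ?case
    by (simp add: algebra_simps)
qed simp

lemma lift_simplex_in_std_simplex:
  assumes n: "1 \<le> n" and x: "x \<in> corner n u"
  shows "lift_simplex n u x \<in> std_simplex n u"
proof -
  have In: "{1..n} = insert n {1..<n}" using n by auto
  have "(\<Sum>i=1..n. lift_simplex n u x i) = lift_simplex n u x n + (\<Sum>i\<in>{1..<n}. x i)"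
    unfolding In by (subst sum.insert) (auto simp: lift_simplex_def intro!: sum.cong)
  then show ?thesis
    using x n by (auto simp: std_simplex_def corner_def lift_simplex_def PiE_def extensional_def)
qed

text \<open>This rewrites the projected set in the area formula \<open>simplex_vol_eq_graph\<close> as a preimage.\<close>

lemma restrict_image_std_simplex:
  assumes n: "1 \<le> n" and C: "C \<subseteq> std_simplex n u"
  shows "(\<lambda>\<theta>. restrict \<theta> {1..<n}) ` C = {x \<in> corner n u. lift_simplex n u x \<in> C}"
proof (intro set_eqI iffI)
  fix x assume x: "x \<in> {x \<in> corner n u. lift_simplex n u x \<in> C}"
  then have "x = restrict (lift_simplex n u x) {1..<n}"
    by (auto simp: corner_def lift_simplex_def fun_eq_iff PiE_def extensional_def)
  with x show "x \<in> (\<lambda>\<theta>. restrict \<theta> {1..<n}) ` C" by blast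
next
  fix x assume "x \<in> (\<lambda>\<theta>. restrict \<theta> {1..<n}) ` C"
  then obtain \<theta> where \<theta>: "\<theta> \<in> C" "x = restrict \<theta> {1..<n}" by auto
  have In: "{1..n} = insert n {1..<n}" using n by auto
  have *: "\<theta> \<in> {1..n} \<rightarrow>\<^sub>E UNIV" "(\<Sum>i\<in>insert n {1..<n}. \<theta> i) = u" "\<forall>i\<in>{1..n}. 0 \<le> \<theta> i"
    using \<theta> C unfolding In[symmetric] by (auto simp: std_simplex_def)
  then have last: "\<theta> n + (\<Sum>i\<in>{1..<n}. \<theta> i) = u" "0 \<le> \<theta> n"
    using n by (auto simp: sum.insert)
  then have "lift_simplex n u x = \<theta>"
    using * by (auto simp: lift_simplex_def \<theta> fun_eq_iff PiE_def extensional_def)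
  then show "x \<in> {x \<in> corner n u. lift_simplex n u x \<in> C}"
    using \<theta> * last by (auto simp: corner_def)
qed

lemma hr_le_lift_simplex_iff:
  assumes n: "1 \<le> n" and x: "x \<in> corner n u" and y: "y \<in> corner n u"
  shows "hr_le n (lift_simplex n u x) (lift_simplex n u y) \<longleftrightarrow> survival_ordered (n - 1) 1 u u x y"
proof -
  let ?x = "lift_simplex n u x" and ?y = "lift_simplex n u y"
  have X: "\<forall>i\<in>{1..n}. 0 \<le> ?x i" "(\<Sum>i=1..n. ?x i) = u" "\<forall>i\<in>{1..n}. 0 \<le> ?y i" "(\<Sum>i=1..n. ?y i) = u"
    using lift_simplex_in_std_simplex[OF n x] lift_simplex_in_std_simplex[OF n y] by (auto simp: std_simplex_def)
  have "hr_le n ?x ?y \<longleftrightarrow> survival_ordered (n - 1) 1 u u ?x ?y"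
    using hr_le_iff_adjacent[OF X(1,3)] survival_ordered_iff_adjacent[of 1 "n - 1" n ?x ?y] X n by simp
  also have "\<dots> \<longleftrightarrow> survival_ordered (n - 1) 1 u u x y"
    using n by (intro survival_ordered_cong) (auto simp: lift_simplex_def)
  finally show ?thesis .
qed

lemma measurable_lift_simplex:
  assumes n: "1 \<le> n"
  shows "lift_simplex n u \<in> measurable (Pi\<^sub>M {1..<n} (\<lambda>_. lborel)) (Pi\<^sub>M {1..n} (\<lambda>_. borel))"
proof (rule measurable_PiM_single')
  fix i assume "i \<in> {1..n}"
  then show "(\<lambda>x. lift_simplex n u x i) \<in> borel_measurable (Pi\<^sub>M {1..<n} (\<lambda>_. lborel))"
    unfolding lift_simplex_def by (cases "i = n") (simp_all, measurable)
next
  show "(\<lambda>x i. lift_simplex n u x i) \<in> space (Pi\<^sub>M {1..<n} (\<lambda>_. lborel)) \<rightarrow> {1..n} \<rightarrow>\<^sub>E space borel"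
    using n by (auto simp: lift_simplex_def space_PiM PiE_def extensional_def)
qed

lemma emeasure_corner:
  assumes "1 \<le> n" "0 \<le> u"
  shows "emeasure (Pi\<^sub>M {1..<n} (\<lambda>_. lborel)) (corner n u) = ennreal (u ^ (n - 1) / fact (n - 1))"
proof -
  have "corner n u = {x. (\<forall>i\<in>{1..<n}. 0 \<le> x i) \<and> sum x {1..<n} \<le> u} \<inter> space (Pi\<^sub>M {1..<n} (\<lambda>_. lborel))"
    by (auto simp: corner_def space_PiM)
  then show ?thesis
    using emeasure_std_simplex_aux[of "{1..<n}" u] assms by simp
qed

lemma sets_corner: "corner n u \<in> sets (Pi\<^sub>M {1..<n} (\<lambda>_. lborel))"
proof -
  have "corner n u = {x \<in> space (Pi\<^sub>M {1..<n} (\<lambda>_. lborel)). (\<forall>i\<in>{1..<n}. 0 \<le> x i) \<and> sum x {1..<n} \<le> u}"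
    by (auto simp: corner_def space_PiM)
  also have "\<dots> \<in> sets (Pi\<^sub>M {1..<n} (\<lambda>_. lborel))" by measurable
  finally show ?thesis .
qed

lemma sets_std_simplex: "std_simplex n u \<in> sets (Pi\<^sub>M {1..n} (\<lambda>_. borel))"
proof -
  have "std_simplex n u = {x \<in> space (Pi\<^sub>M {1..n} (\<lambda>_. borel)). sum x {1..n} = u \<and> (\<forall>i\<in>{1..n}. 0 \<le> x i)}"
    by (auto simp: std_simplex_def space_PiM)
  also have "\<dots> \<in> sets (Pi\<^sub>M {1..n} (\<lambda>_. borel))" by measurable
  finally show ?thesis .
qed

lemma measurable_lift_simplex_uniform:
  assumes "1 \<le> n"
  shows "lift_simplex n u \<in> measurable (uniform_measure (Pi\<^sub>M {1..<n} (\<lambda>_. lborel)) A) (Pi\<^sub>M {1..n} (\<lambda>_. borel))"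
  by (subst measurable_cong_sets[OF sets_uniform_measure refl]) (rule measurable_lift_simplex[OF assms])

text \<open>
  The area element \<open>sqrt n\<close> of the graph is constant and cancels in the quotient of volumes. The
  hypothesis only speaks about subsets of the simplex; its instance for the whole simplex shows that
  the vector lies there almost surely, which extends the formula to all measurable sets.
\<close>

lemma distr_uniform_on_simplex:
  assumes "prob_space M" and n: "1 \<le> n" and u: "0 < u" and X: "uniform_on_simplex M n u X"
  shows "distr M (Pi\<^sub>M {1..n} (\<lambda>_. borel)) X =
    distr (uniform_measure (Pi\<^sub>M {1..<n} (\<lambda>_. lborel)) (corner n u)) (Pi\<^sub>M {1..n} (\<lambda>_. borel)) (lift_simplex n u)"
proof (rule measure_eqI)
  interpret prob_space M by fact
  let ?N = "Pi\<^sub>M {1..n} (\<lambda>_. borel) :: (nat \<Rightarrow> real) measure"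
  let ?L = "Pi\<^sub>M {1..<n} (\<lambda>_. lborel) :: (nat \<Rightarrow> real) measure"
  let ?D = "corner n u" and ?S = "std_simplex n u" and ?g = "lift_simplex n u"
  note [measurable] = measurable_lift_simplex[OF n] sets_corner sets_std_simplex
  have X_meas [measurable]: "X \<in> measurable M ?N"
    using X by (simp add: uniform_on_simplex_def)
  have V: "emeasure ?L ?D \<noteq> 0" "emeasure ?L ?D \<noteq> \<infinity>"
    using emeasure_corner[OF n, of u] u by auto
  have V': "0 < measure ?L ?D"
    using V by (simp add: measure_def enn2real_positive_iff less_top zero_less_iff_neq_zero)
  have vol: "simplex_vol n C = sqrt n * measure ?L {x \<in> ?D. ?g x \<in> C}"
    if "C \<in> sets ?N" "C \<subseteq> ?S" for C
    using simplex_vol_eq_graph[OF n that] restrict_image_std_simplex[OF n that(2)] by simp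
  have in_S: "{x \<in> ?D. ?g x \<in> ?S} = ?D"
    using lift_simplex_in_std_simplex[OF n] by auto
  have prob: "prob {\<omega> \<in> space M. X \<omega> \<in> C} = measure ?L {x \<in> ?D. ?g x \<in> C} / measure ?L ?D"
    if "C \<in> sets ?N" "C \<subseteq> ?S" for C
    using X that n vol[OF that] vol[OF sets_std_simplex order_refl] in_S
    by (simp add: uniform_on_simplex_def)
  have "prob {\<omega> \<in> space M. X \<omega> \<in> ?S} = 1"
    using prob[OF sets_std_simplex order_refl] V' in_S by simp
  then have AE_S: "AE \<omega> in M. X \<omega> \<in> ?S"
    by (subst (asm) prob_Collect_eq_1) measurable
  fix A assume "A \<in> sets (distr M ?N X)"
  then have A [measurable]: "A \<in> sets ?N" by simp
  have "emeasure (distr M ?N X) A = prob {\<omega> \<in> space M. X \<omega> \<in> A}"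
    by (subst emeasure_distr[OF X_meas A])
       (simp add: emeasure_eq_measure vimage_def Int_def conj_commute)
  also have "prob {\<omega> \<in> space M. X \<omega> \<in> A} = prob {\<omega> \<in> space M. X \<omega> \<in> A \<inter> ?S}"
    using AE_S by (intro finite_measure_eq_AE) (auto elim: eventually_mono, measurable)
  also have "\<dots> = measure ?L {x \<in> ?D. ?g x \<in> A \<inter> ?S} / measure ?L ?D"
    by (rule prob) (use A sets_std_simplex in blast)+
  also have "{x \<in> ?D. ?g x \<in> A \<inter> ?S} = ?D \<inter> (?g -` A \<inter> space ?L)"
    using lift_simplex_in_std_simplex[OF n, of _ u] by (auto simp: corner_def space_PiM)
  also have "measure ?L (?D \<inter> (?g -` A \<inter> space ?L)) / measure ?L ?D =
      measure (uniform_measure ?L ?D) (?g -` A \<inter> space ?L)"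
    by (subst measure_uniform_measure[OF V]) (simp_all del: One_nat_def)
  also have "ennreal \<dots> = emeasure (uniform_measure ?L ?D) (?g -` A \<inter> space ?L)"
    using prob_space_uniform_measure[OF V] by (intro finite_measure.emeasure_eq_measure[symmetric] prob_space.finite_measure)
  also have "\<dots> = emeasure (distr (uniform_measure ?L ?D) ?N ?g) A"
    by (subst emeasure_distr[OF measurable_lift_simplex_uniform[OF n] A]) (simp del: One_nat_def)
  finally show "emeasure (distr M ?N X) A = emeasure (distr (uniform_measure ?L ?D) ?N ?g) A" .
qed simp

lemma pred_hr_le:
  "Measurable.pred (Pi\<^sub>M {1..n} (\<lambda>_. borel) \<Otimes>\<^sub>M Pi\<^sub>M {1..n} (\<lambda>_. borel)) (\<lambda>z. hr_le n (fst z) (snd z))"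
proof -
  let ?N = "Pi\<^sub>M {1..n} (\<lambda>_. borel) :: (nat \<Rightarrow> real) measure"
  have *: "(\<lambda>x. \<Sum>k=i..n. x k) \<in> borel_measurable ?N" if "1 \<le> i" for i
    using that by (intro borel_measurable_sum measurable_component_singleton) auto
  have S: "(\<lambda>z. \<Sum>k=i..n. fst z k) \<in> borel_measurable (?N \<Otimes>\<^sub>M ?N)"
      "(\<lambda>z. \<Sum>k=i..n. snd z k) \<in> borel_measurable (?N \<Otimes>\<^sub>M ?N)" if "1 \<le> i" for i
    using measurable_compose[OF measurable_fst *[OF that]] measurable_compose[OF measurable_snd *[OF that]]
    by blast+
  have "hr_le n x y \<longleftrightarrow> (\<forall>i\<in>{1..n}. \<forall>j\<in>{i..n}.
      (\<Sum>k=j..n. x k) * (\<Sum>k=i..n. y k) \<le> (\<Sum>k=i..n. x k) * (\<Sum>k=j..n. y k))" for x y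
    by (auto simp: hr_le_def)
  note eq = this
  show ?thesis
    unfolding eq
  proof (intro pred_intros_finite finite_atLeastAtMost)
    fix i j assume "i \<in> {1..n}" "j \<in> {i..n}"
    then have ij: "1 \<le> i" "1 \<le> j" by auto
    show "Measurable.pred (?N \<Otimes>\<^sub>M ?N) (\<lambda>z. (\<Sum>k=j..n. fst z k) * (\<Sum>k=i..n. snd z k) \<le>
        (\<Sum>k=i..n. fst z k) * (\<Sum>k=j..n. snd z k))"
      using S[OF ij(1)] S[OF ij(2)] by measurable
  qed
qed

section \<open>The probability of the hazard rate order\<close>

text \<open>
  By independence the joint law is a product, so the probability is an iterated integral over two
  copies of \<^const>\<open>corner\<close>, divided by the square of its volume.
\<close>

theorem theorem4p4:
  fixes M :: "'a measure" and n :: nat and u :: real and \<Theta> \<Theta>' :: "'a \<Rightarrow> nat \<Rightarrow> real"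
  assumes "prob_space M"
    and "n \<ge> 2" and "u > 0"
    and "prob_space.indep_var M (Pi\<^sub>M {1..n} (\<lambda>_. borel)) \<Theta> (Pi\<^sub>M {1..n} (\<lambda>_. borel)) \<Theta>'"
    and "uniform_on_simplex M n u \<Theta>" and "uniform_on_simplex M n u \<Theta>'"
  shows "measure M {\<omega> \<in> space M. hr_le n (\<Theta> \<omega>) (\<Theta>' \<omega>)} = 1 / 2 ^ (n - 1)"
proof -
  interpret prob_space M by fact
  let ?N = "Pi\<^sub>M {1..n} (\<lambda>_. borel) :: (nat \<Rightarrow> real) measure"
  let ?L = "Pi\<^sub>M {1..<n} (\<lambda>_. lborel) :: (nat \<Rightarrow> real) measure"
  let ?D = "corner n u" and ?g = "lift_simplex n u"
  let ?U = "uniform_measure ?L ?D"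
  define H where "H = {z \<in> space (?N \<Otimes>\<^sub>M ?N). hr_le n (fst z) (snd z)}"
  have n: "1 \<le> n" using assms(2) by simp
  note [measurable] = measurable_lift_simplex[OF n] sets_corner pred_hr_le
  have H [measurable]: "H \<in> sets (?N \<Otimes>\<^sub>M ?N)" unfolding H_def by measurable
  have rv [measurable]: "\<Theta> \<in> measurable M ?N" "\<Theta>' \<in> measurable M ?N"
    using assms(5,6) by (auto simp: uniform_on_simplex_def)
  define V where "V = u ^ (n - 1) / fact (n - 1)"
  have V: "emeasure ?L ?D = ennreal V" "0 < V"
    using emeasure_corner[OF n, of u] assms(3) by (auto simp: V_def)
  have gU_meas: "?g \<in> measurable ?U ?N"
    by (rule measurable_lift_simplex_uniform[OF n])
  interpret U: prob_space ?U
    using V by (intro prob_space_uniform_measure) auto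
  interpret gU: prob_space "distr ?U ?N ?g"
    by (rule U.prob_space_distr) (rule gU_meas)
  interpret L: sigma_finite_measure ?L
    by (intro lborel_product.sigma_finite) simp
  have joint: "distr M (?N \<Otimes>\<^sub>M ?N) (\<lambda>\<omega>. (\<Theta> \<omega>, \<Theta>' \<omega>)) = distr ?U ?N ?g \<Otimes>\<^sub>M distr ?U ?N ?g"
    using assms(4) distr_uniform_on_simplex[OF assms(1) n assms(3)] assms(5,6)
    by (simp add: indep_var_distribution_eq)
  have gspace: "?g x \<in> space ?N" if "x \<in> space ?L" for x
    using measurable_space[OF measurable_lift_simplex[OF n] that] .
  have "emeasure M {\<omega> \<in> space M. hr_le n (\<Theta> \<omega>) (\<Theta>' \<omega>)} =
      emeasure (distr M (?N \<Otimes>\<^sub>M ?N) (\<lambda>\<omega>. (\<Theta> \<omega>, \<Theta>' \<omega>))) H"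
    using measurable_space[OF rv(1)] measurable_space[OF rv(2)]
    by (subst emeasure_distr[OF measurable_Pair[OF rv] H])
       (auto simp: H_def space_pair_measure intro!: arg_cong[of _ _ "emeasure M"])
  also have "\<dots> = (\<integral>\<^sup>+x. \<integral>\<^sup>+y. indicator H (x, y) \<partial>distr ?U ?N ?g \<partial>distr ?U ?N ?g)"
    unfolding joint by (rule gU.emeasure_pair_measure) (simp del: One_nat_def cong: sets_pair_measure_cong)
  also have "\<dots> = (\<integral>\<^sup>+x. \<integral>\<^sup>+y. indicator H (?g x, y) \<partial>distr ?U ?N ?g \<partial>?U)"
    by (rule nn_integral_distr[OF gU_meas], rule gU.borel_measurable_nn_integral)
       (simp add: split_beta' del: One_nat_def cong: measurable_cong_sets sets_pair_measure_cong)
  also have "\<dots> = (\<integral>\<^sup>+x. \<integral>\<^sup>+y. indicator H (?g x, ?g y) \<partial>?U \<partial>?U)"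
  proof (intro nn_integral_cong nn_integral_distr[OF gU_meas])
    fix x assume "x \<in> space ?U"
    then have "?g x \<in> space ?N" using gspace by simp
    then show "(\<lambda>y. indicator H (?g x, y) :: ennreal) \<in> borel_measurable (distr ?U ?N ?g)"
      by (simp del: One_nat_def)
  qed
  also have "\<dots> = (\<integral>\<^sup>+x. (\<integral>\<^sup>+y. indicator H (?g x, ?g y) * indicator ?D y \<partial>?L) / ennreal V \<partial>?U)"
    unfolding V(1)[symmetric]
  proof (intro nn_integral_cong nn_integral_uniform_measure sets_corner)
    fix x assume "x \<in> space ?U"
    then have [measurable]: "?g x \<in> space ?N" using gspace by simp
    show "(\<lambda>y. indicator H (?g x, ?g y) :: ennreal) \<in> borel_measurable ?L" by measurable
  qed
  also have "\<dots> = (\<integral>\<^sup>+x. (\<integral>\<^sup>+y. indicator H (?g x, ?g y) * indicator ?D y \<partial>?L) / ennreal V * indicator ?D x \<partial>?L) / ennreal V"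
    unfolding V(1)[symmetric]
    by (intro nn_integral_uniform_measure sets_corner) measurable
  also have "\<dots> = (\<integral>\<^sup>+x. (\<integral>\<^sup>+y. indicator H (?g x, ?g y) * indicator ?D y * indicator ?D x \<partial>?L) / ennreal V \<partial>?L) / ennreal V"
  proof (intro arg_cong2[of _ _ _ _ "(/)"] nn_integral_cong refl)
    fix x
    show "(\<integral>\<^sup>+y. indicator H (?g x, ?g y) * indicator ?D y \<partial>?L) / ennreal V * indicator ?D x =
        (\<integral>\<^sup>+y. indicator H (?g x, ?g y) * indicator ?D y * indicator ?D x \<partial>?L) / ennreal V"
      by (simp add: indicator_def)
  qed
  also have "\<dots> = (\<integral>\<^sup>+x. (\<integral>\<^sup>+y. indicator H (?g x, ?g y) * indicator ?D y * indicator ?D x \<partial>?L) \<partial>?L) / ennreal V / ennreal V"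
    by (subst nn_integral_divide) measurable
  also have "(\<integral>\<^sup>+x. (\<integral>\<^sup>+y. indicator H (?g x, ?g y) * indicator ?D y * indicator ?D x \<partial>?L) \<partial>?L) =
      (\<integral>\<^sup>+x. \<integral>\<^sup>+y. of_bool (survival_ordered (n - 1) 1 u u x y) \<partial>?L \<partial>?L)"
  proof (intro nn_integral_cong)
    fix x y assume xy: "x \<in> space ?L" "y \<in> space ?L"
    have "x \<in> ?D \<and> y \<in> ?D" if "survival_ordered (n - 1) 1 u u x y"
      using survival_ordered_imp_corner[OF that] assms(3) n xy by (auto simp: corner_def space_PiM)
    then show "indicator H (?g x, ?g y) * indicator ?D y * indicator ?D x =
        (of_bool (survival_ordered (n - 1) 1 u u x y) :: ennreal)"
      using hr_le_lift_simplex_iff[OF n, of x u y] gspace xy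
      by (auto simp: H_def indicator_def space_pair_measure)
  qed
  also have "\<dots> = ennreal ((u * u) ^ (n - 1) / (2 ^ (n - 1) * (fact (n - 1))\<^sup>2))"
    using nn_integral_survival_ordered[where m = "n - 1" and k = 1 and a = u and b = u] assms(3) n by (simp del: One_nat_def)
  also have "\<dots> / ennreal V / ennreal V = ennreal (1 / 2 ^ (n - 1))"
    using V assms(3) by (simp add: divide_ennreal V_def power_mult_distrib power2_eq_square)
  finally show ?thesis
    by (simp add: emeasure_eq_measure)
qed

end
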